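(* Let $k\ge 0$ and let $\mathbb{A}$ be a graph of groups with finite underlying graph such that, for each vertex $u$, the vertex group $A_u$ has the $k$-f.c.i.p. relative to the collection $\{\alpha_e(A_e)\}_{e\in\mathrm{Star}(u)}$ of adjacent edge groups. Let $\mu^B\colon\mathbb{B}\to\mathbb{A}$ and $\mu^C\colon\mathbb{C}\to\mathbb{A}$ be immersions, where $\mathbb{B}$ and $\mathbb{C}$ are finite graphs of finitely generated groups. Then the $\mathbb{A}$-product $\mathbb{B}\,\widetilde{\times}_{\mathbb{A}}\,\mathbb{C}$ is locally finite and has only finitely many vertices with strictly more than $k$ outgoing edges. In particular: (1) if $k=0$, then $\mathbb{B}\,\widetilde{\times}_{\mathbb{A}}\,\mathbb{C}$ has finitely many edges; (2) if $k=1$, then each connected component of $\mathbb{B}\,\widetilde{\times}_{\mathbb{A}}\,\mathbb{C}$ has finitely many edges.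
   Context: Conventions: $x^g=g^{-1}xg$, $H^g=g^{-1}Hg$, $\gamma_g(x)=x^g$; $H\backslash G/K$ is the set of double cosets $HgK$. $k$-f.c.i.p.: for finitely generated subgroups $A,B,C\le G$ and $f,g\in G$, let $q^A_{f,g}\colon (A\cap B^f)\backslash A/(A\cap C^g)\to B\backslash G/C$ be the (well-defined) map $(A\cap B^f)a(A\cap C^g)\mapsto B\,fag^{-1}\,C$. Let $\mathcal A$ be a collection (indexed family) of finitely generated subgroups of $G$. $G$ has the $k$-f.c.i.p. relative to $\mathcal A$ if for every pair $B,C$ of finitely generated subgroups of $G$ and every choice, for each $A\in\mathcal A$, of finite sets $\mathcal F_A,\mathcal G_A\subset G$ whose elements lie in pairwise distinct $(B,A)$-double cosets, respectively $(C,A)$-double cosets, $$\sum_{BhC\in B\backslash G/C}\max\Big\{0,\Big(\sum_{A\in\mathcal A}\ \sum_{f\in\mathcal F_A,\,g\in\mathcal G_A}\big|(q^A_{f,g})^{-1}(BhC)\big|\Big)-k\Big\}<\infty .$$ Graphs are directed with edge inversion: a graph $\mathsf A$ has vertices $V(\mathsf A)$, edges $E(\mathsf A)$, origin and target maps $o,t$, and a fixpoint-free involution $e\mapsto e^{-1}$ with $t(e^{-1})=o(e)$; $\mathrm{Star}(u)=\{e:o(e)=u\}$ is the set of outgoing edges at $u$; a graph is locally finite if all stars are finite. A graph of groups $\mathbb A$ consists of an underlying graph $\mathsf A$, vertex groups $A_u$, edge groups $A_e=A_{e^{-1}}$, and monomorphisms $\alpha_e\colon A_e\to A_{o(e)}$,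 $\omega_e\colon A_e\to A_{t(e)}$ with $\alpha_{e^{-1}}=\omega_e$. A finite graph of finitely generated groups is one with finite underlying graph and finitely generated vertex and edge groups. A morphism $\mu\colon\mathbb B\to\mathbb A$ consists of a graph morphism $\mathsf B\to\mathsf A$ (also written $\mu$), monomorphisms $\mu_v\colon B_v\to A_{\mu(v)}$, $\mu_f\colon B_f\to A_{\mu(f)}$ (with $\mu_{f^{-1}}=\mu_f$), and twisting elements $f_\alpha\in A_{\mu(o(f))}$, $f_\omega\in A_{\mu(t(f))}$ with $(f^{-1})_\alpha=f_\omega$, such that for every edge $f$ with $\mu(f)=e$: $\alpha_e\circ\mu_f=\gamma_{f_\alpha}\circ\mu_{o(f)}\circ\alpha_f$ and $\omega_e\circ\mu_f=\gamma_{f_\omega}\circ\mu_{t(f)}\circ\omega_f$. It is an immersion if (i) whenever $f,f'$ are edges of $\mathsf B$ with the same origin $v$ and the same image $e$, one has $f=f'$ if and only if $\mu_v(B_v)f_\alpha\alpha_e(A_e)=\mu_v(B_v)f'_\alpha\alpha_e(A_e)$; and (ii) for every edge $f$ with $\mu(f)=e$, $o(f)=v$: $\alpha_e(\mu_f(B_f))=\mu_v(B_v)^{f_\alpha}\cap\alpha_e(A_e)$. The $\mathbb A$-product $\mathbb B\,\widetilde\times_{\mathbb A}\,\mathbb C$ is a graph of groups; only its underlying graph matters here. Its vertex set is the disjoint union, over pairs $(v,w)\in V(\mathsf B)\times V(\mathsf C)$ with common image $u\in V(\mathsf A)$, of the sets $\mu^B_v(B_v)\backslash A_u/\mu^C_w(C_w)$.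 Its edge set is the disjoint union, over pairs $(f,g)\in E(\mathsf B)\times E(\mathsf C)$ with common image $e\in E(\mathsf A)$, of the sets $\mu^B_f(B_f)\backslash A_e/\mu^C_g(C_g)$; the inverse of an $(f,g)$-edge is the same double coset regarded as an $(f^{-1},g^{-1})$-edge. For an $(f,g)$-edge $\mu^B_f(B_f)\,a\,\mu^C_g(C_g)$ with $f$ from $v$ to $v'$ and $g$ from $w$ to $w'$, $$o=\mu^B_v(B_v)\,f_\alpha\alpha_e(a)g_\alpha^{-1}\,\mu^C_w(C_w),\qquad t=\mu^B_{v'}(B_{v'})\,f_\omega\omega_e(a)g_\omega^{-1}\,\mu^C_{w'}(C_{w'}).$$ *)

theory Defs
  imports
    "HOL-Algebra.Coset"
    "HOL-Algebra.Generated_Groups"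
    "HOL-Analysis.Infinite_Sum"
    "HOL-Analysis.Measure_Space"
begin

section \<open>Conjugates, double cosets and finite generation\<close>

definition gconj :: "('a, 'm) monoid_scheme \<Rightarrow> 'a \<Rightarrow> 'a \<Rightarrow> 'a" where
  "gconj G g x = inv\<^bsub>G\<^esub> g \<otimes>\<^bsub>G\<^esub> x \<otimes>\<^bsub>G\<^esub> g"

definition dcoset :: "('a, 'm) monoid_scheme \<Rightarrow> 'a set \<Rightarrow> 'a \<Rightarrow> 'a set \<Rightarrow> 'a set" where
  "dcoset G H g K = (H #>\<^bsub>G\<^esub> g) <#>\<^bsub>G\<^esub> K"

definition double_cosets :: "('a, 'm) monoid_scheme \<Rightarrow> 'a set \<Rightarrow> 'a set \<Rightarrow> 'a set set" where
  "double_cosets G H K = (\<lambda>g. dcoset G H g K) ` carrier G"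

definition fg_group :: "('a, 'm) monoid_scheme \<Rightarrow> bool" where
  "fg_group G \<longleftrightarrow> group G \<and> (\<exists>S. finite S \<and> S \<subseteq> carrier G \<and> carrier G = generate G S)"

definition fg_subgroup :: "('a, 'm) monoid_scheme \<Rightarrow> 'a set \<Rightarrow> bool" where
  "fg_subgroup G H \<longleftrightarrow> subgroup H G \<and> (\<exists>S. finite S \<and> S \<subseteq> carrier G \<and> H = generate G S)"


section \<open>The relative k-f.c.i.p.\<close>

text \<open>
  The map sending a double coset \<open>D\<close> of the representative \<open>a\<close> to \<open>B f a g\<inverse> C\<close>. The union
  over all \<open>a \<in> D\<close> avoids choosing a representative; the lemma \<open>q_map_dcoset\<close> shows that every
  single representative already gives the whole union.
\<close>

definition q_map ::
  "('a, 'm) monoid_scheme \<Rightarrow> 'a set \<Rightarrow> 'a set \<Rightarrow> 'a \<Rightarrow> 'a \<Rightarrow> 'a set \<Rightarrow> 'a set" where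
  "q_map G B C f g D = (\<Union>a\<in>D. dcoset G B (f \<otimes>\<^bsub>G\<^esub> a \<otimes>\<^bsub>G\<^esub> inv\<^bsub>G\<^esub> g) C)"

definition q_fibre ::
  "('a, 'm) monoid_scheme \<Rightarrow> 'a set \<Rightarrow> 'a set \<Rightarrow> 'a set \<Rightarrow> 'a \<Rightarrow> 'a \<Rightarrow> 'a set \<Rightarrow> 'a set set" where
  "q_fibre G A B C f g D =
     {E \<in> double_cosets (G\<lparr>carrier := A\<rparr>) (A \<inter> gconj G f ` B) (A \<inter> gconj G g ` C).
        q_map G B C f g E = D}"

text \<open>
  Cardinalities and sums are taken in \<^typ>\<open>ennreal\<close>, so that fibres, the collection and the set of
  double cosets may all be infinite. Subtraction on \<^typ>\<open>ennreal\<close> is truncated at \<open>0\<close>, so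
  \<open>x - ennreal k\<close> is \<open>max {0, x - k}\<close> (and \<open>\<infinity> - k = \<infinity>\<close>).
\<close>

definition fcip_relative ::
  "real \<Rightarrow> ('a, 'm) monoid_scheme \<Rightarrow> 'i set \<Rightarrow> ('i \<Rightarrow> 'a set) \<Rightarrow> bool" where
  "fcip_relative k G I A \<longleftrightarrow>
     group G \<and> (\<forall>i\<in>I. fg_subgroup G (A i)) \<and>
     (\<forall>B C FF GG.
        fg_subgroup G B \<longrightarrow> fg_subgroup G C \<longrightarrow>
        (\<forall>i\<in>I. finite (FF i) \<and> FF i \<subseteq> carrier G \<and> inj_on (\<lambda>f. dcoset G B f (A i)) (FF i)) \<longrightarrow>
        (\<forall>i\<in>I. finite (GG i) \<and> GG i \<subseteq> carrier G \<and> inj_on (\<lambda>g. dcoset G C g (A i)) (GG i)) \<longrightarrow>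
        (\<Sum>\<^sub>\<infinity>D\<in>double_cosets G B C.
           (\<Sum>\<^sub>\<infinity>i\<in>I. \<Sum>f\<in>FF i. \<Sum>g\<in>GG i.
              emeasure (count_space UNIV) (q_fibre G (A i) B C f g D)) - ennreal k) < \<infinity>)"


section \<open>Graphs with edge inversion\<close>

record ('v, 'e) sgraph =
  verts :: "'v set"
  edges :: "'e set"
  org :: "'e \<Rightarrow> 'v"
  einv :: "'e \<Rightarrow> 'e"

definition is_graph :: "('v, 'e, 'm) sgraph_scheme \<Rightarrow> bool" where
  "is_graph X \<longleftrightarrow>
     (\<forall>e\<in>edges X. org X e \<in> verts X \<and> einv X e \<in> edges X \<and> einv X e \<noteq> e \<and> einv X (einv X e) = e)"

definition tgt :: "('v, 'e, 'm) sgraph_scheme \<Rightarrow> 'e \<Rightarrow> 'v" where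
  "tgt X e = org X (einv X e)"

definition star :: "('v, 'e, 'm) sgraph_scheme \<Rightarrow> 'v \<Rightarrow> 'e set" where
  "star X u = {e \<in> edges X. org X e = u}"

definition locally_finite :: "('v, 'e, 'm) sgraph_scheme \<Rightarrow> bool" where
  "locally_finite X \<longleftrightarrow> (\<forall>u\<in>verts X. finite (star X u))"

definition finite_graph :: "('v, 'e, 'm) sgraph_scheme \<Rightarrow> bool" where
  "finite_graph X \<longleftrightarrow> finite (verts X) \<and> finite (edges X)"

text \<open>The vertex set of the connected component of \<open>u\<close>; symmetric because edges are invertible.\<close>

definition component :: "('v, 'e, 'm) sgraph_scheme \<Rightarrow> 'v \<Rightarrow> 'v set" where
  "component X u = {w. (u, w) \<in> {(org X e, tgt X e) | e. e \<in> edges X}\<^sup>*}"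


section \<open>Graphs of groups\<close>

text \<open>
  \<open>emb e\<close> is \<open>\<alpha>\<^sub>e\<close>; the other boundary map is \<open>\<omega>\<^sub>e = \<alpha>\<close> of the inverse edge.
\<close>

record ('v, 'e, 'a, 'b) graph_of_groups = "('v, 'e) sgraph" +
  vgrp :: "'v \<Rightarrow> 'a monoid"
  egrp :: "'e \<Rightarrow> 'b monoid"
  emb :: "'e \<Rightarrow> 'b \<Rightarrow> 'a"

definition is_graph_of_groups :: "('v, 'e, 'a, 'b) graph_of_groups \<Rightarrow> bool" where
  "is_graph_of_groups A \<longleftrightarrow>
     is_graph A \<and>
     (\<forall>u\<in>verts A. group (vgrp A u)) \<and>
     (\<forall>e\<in>edges A. group (egrp A e) \<and> egrp A (einv A e) = egrp A e \<and>
        emb A e \<in> mon (egrp A e) (vgrp A (org A e)))"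

definition edge_subgroup :: "('v, 'e, 'a, 'b) graph_of_groups \<Rightarrow> 'e \<Rightarrow> 'a set" where
  "edge_subgroup A e = emb A e ` carrier (egrp A e)"

definition finite_graph_of_fg_groups :: "('v, 'e, 'a, 'b) graph_of_groups \<Rightarrow> bool" where
  "finite_graph_of_fg_groups A \<longleftrightarrow>
     is_graph_of_groups A \<and> finite_graph A \<and>
     (\<forall>u\<in>verts A. fg_group (vgrp A u)) \<and> (\<forall>e\<in>edges A. fg_group (egrp A e))"

text \<open>
  \<open>twist f\<close> is \<open>f\<^sub>\<alpha>\<close>, and \<open>f\<^sub>\<omega>\<close> is \<open>twist\<close> of the inverse of \<open>f\<close>. Hence the compatibility
  condition for \<open>\<omega>\<close> at \<open>f\<close> is the one for \<open>\<alpha>\<close> at the inverse edge.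
\<close>

record ('v, 'e, 'a, 'b, 'v1, 'e1, 'a1, 'b1) gog_map =
  vmap :: "'v \<Rightarrow> 'v1"
  emap :: "'e \<Rightarrow> 'e1"
  vhom :: "'v \<Rightarrow> 'a \<Rightarrow> 'a1"
  ehom :: "'e \<Rightarrow> 'b \<Rightarrow> 'b1"
  twist :: "'e \<Rightarrow> 'a1"

definition gog_morphism ::
  "('v, 'e, 'a, 'b) graph_of_groups \<Rightarrow> ('v1, 'e1, 'a1, 'b1) graph_of_groups \<Rightarrow>
   ('v, 'e, 'a, 'b, 'v1, 'e1, 'a1, 'b1) gog_map \<Rightarrow> bool" where
  "gog_morphism B A \<mu> \<longleftrightarrow>
     (\<forall>v\<in>verts B. vmap \<mu> v \<in> verts A \<and> vhom \<mu> v \<in> mon (vgrp B v) (vgrp A (vmap \<mu> v))) \<and>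
     (\<forall>f\<in>edges B.
        emap \<mu> f \<in> edges A \<and>
        vmap \<mu> (org B f) = org A (emap \<mu> f) \<and>
        emap \<mu> (einv B f) = einv A (emap \<mu> f) \<and>
        ehom \<mu> f \<in> mon (egrp B f) (egrp A (emap \<mu> f)) \<and>
        twist \<mu> f \<in> carrier (vgrp A (vmap \<mu> (org B f))) \<and>
        (\<forall>x\<in>carrier (egrp B f).
           ehom \<mu> (einv B f) x = ehom \<mu> f x \<and>
           emb A (emap \<mu> f) (ehom \<mu> f x) =
             gconj (vgrp A (vmap \<mu> (org B f))) (twist \<mu> f) (vhom \<mu> (org B f) (emb B f x))))"

definition vimg ::
  "('v, 'e, 'a, 'b) graph_of_groups \<Rightarrow> ('v, 'e, 'a, 'b, 'v1, 'e1, 'a1, 'b1) gog_map \<Rightarrow>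
   'v \<Rightarrow> 'a1 set" where
  "vimg B \<mu> v = vhom \<mu> v ` carrier (vgrp B v)"

definition eimg ::
  "('v, 'e, 'a, 'b) graph_of_groups \<Rightarrow> ('v, 'e, 'a, 'b, 'v1, 'e1, 'a1, 'b1) gog_map \<Rightarrow>
   'e \<Rightarrow> 'b1 set" where
  "eimg B \<mu> f = ehom \<mu> f ` carrier (egrp B f)"

definition gog_immersion ::
  "('v, 'e, 'a, 'b) graph_of_groups \<Rightarrow> ('v1, 'e1, 'a1, 'b1) graph_of_groups \<Rightarrow>
   ('v, 'e, 'a, 'b, 'v1, 'e1, 'a1, 'b1) gog_map \<Rightarrow> bool" where
  "gog_immersion B A \<mu> \<longleftrightarrow>
     gog_morphism B A \<mu> \<and>
     (\<forall>f\<in>edges B. \<forall>f'\<in>edges B.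
        org B f = org B f' \<longrightarrow> emap \<mu> f = emap \<mu> f' \<longrightarrow>
        (f = f' \<longleftrightarrow>
           dcoset (vgrp A (vmap \<mu> (org B f))) (vimg B \<mu> (org B f)) (twist \<mu> f)
             (edge_subgroup A (emap \<mu> f)) =
           dcoset (vgrp A (vmap \<mu> (org B f))) (vimg B \<mu> (org B f)) (twist \<mu> f')
             (edge_subgroup A (emap \<mu> f)))) \<and>
     (\<forall>f\<in>edges B.
        emb A (emap \<mu> f) ` eimg B \<mu> f =
          gconj (vgrp A (vmap \<mu> (org B f))) (twist \<mu> f) ` vimg B \<mu> (org B f)
          \<inter> edge_subgroup A (emap \<mu> f))"


section \<open>The underlying graph of the product\<close>

text \<open>
  A vertex is a triple \<open>(v, w, D)\<close> and an edge a triple \<open>(f, g, D)\<close> with \<open>D\<close> a double coset; the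
  first two components make the unions disjoint. The origin of the \<open>(f, g)\<close>-edge of \<open>a\<close> is
  \<open>B\<^sub>v f\<^sub>\<alpha> \<alpha>\<^sub>e(a) g\<^sub>\<alpha>\<inverse> C\<^sub>w\<close> (see \<open>org_aproduct\<close> below), and its target, being the origin of the inverse
  edge, is the corresponding expression with \<open>\<omega>\<close> in place of \<open>\<alpha>\<close> (see \<open>tgt_aproduct\<close>).
\<close>

definition aproduct ::
  "('v, 'e, 'a, 'b) graph_of_groups \<Rightarrow>
   ('v1, 'e1, 'a1, 'b1) graph_of_groups \<Rightarrow> ('v2, 'e2, 'a2, 'b2) graph_of_groups \<Rightarrow>
   ('v1, 'e1, 'a1, 'b1, 'v, 'e, 'a, 'b) gog_map \<Rightarrow>
   ('v2, 'e2, 'a2, 'b2, 'v, 'e, 'a, 'b) gog_map \<Rightarrow>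
   ('v1 \<times> 'v2 \<times> 'a set, 'e1 \<times> 'e2 \<times> 'b set) sgraph" where
  "aproduct A B C \<mu> \<nu> =
     \<lparr>verts = {(v, w, D). v \<in> verts B \<and> w \<in> verts C \<and> vmap \<mu> v = vmap \<nu> w \<and>
                 D \<in> double_cosets (vgrp A (vmap \<mu> v)) (vimg B \<mu> v) (vimg C \<nu> w)},
      edges = {(f, g, D). f \<in> edges B \<and> g \<in> edges C \<and> emap \<mu> f = emap \<nu> g \<and>
                 D \<in> double_cosets (egrp A (emap \<mu> f)) (eimg B \<mu> f) (eimg C \<nu> g)},
      org = (\<lambda>(f, g, D).
               (org B f, org C g,
                q_map (vgrp A (vmap \<mu> (org B f))) (vimg B \<mu> (org B f)) (vimg C \<nu> (org C g))
                  (twist \<mu> f) (twist \<nu> g) (emb A (emap \<mu> f) ` D))),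
      einv = (\<lambda>(f, g, D). (einv B f, einv C g, D))\<rparr>"


section \<open>Well-definedness\<close>

lemma mem_dcoset: "x \<in> dcoset G H g K \<longleftrightarrow> (\<exists>h\<in>H. \<exists>k\<in>K. x = h \<otimes>\<^bsub>G\<^esub> g \<otimes>\<^bsub>G\<^esub> k)"
  by (auto simp: dcoset_def r_coset_def set_mult_def)

lemma (in group) dcoset_absorb:
  assumes "subgroup B G" "subgroup C G" "b \<in> B" "c \<in> C" "x \<in> carrier G"
  shows "dcoset G B (b \<otimes> x \<otimes> c) C = dcoset G B x C"
proof -
  note sub = subgroup.mem_carrier[OF assms(1)] subgroup.mem_carrier[OF assms(2)]
  have *: "dcoset G B (b \<otimes> y \<otimes> c) C \<subseteq> dcoset G B y C"
    if "b \<in> B" "c \<in> C" "y \<in> carrier G" for b c y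
  proof
    fix z assume "z \<in> dcoset G B (b \<otimes> y \<otimes> c) C"
    then obtain h k where hk: "h \<in> B" "k \<in> C" "z = h \<otimes> (b \<otimes> y \<otimes> c) \<otimes> k"
      by (auto simp: mem_dcoset)
    then have "z = (h \<otimes> b) \<otimes> y \<otimes> (c \<otimes> k)"
      using that sub by (simp add: m_assoc)
    then show "z \<in> dcoset G B y C"
      using hk that subgroup.m_closed[OF assms(1)] subgroup.m_closed[OF assms(2)]
      unfolding mem_dcoset by blast
  qed
  have "x = inv b \<otimes> (b \<otimes> x \<otimes> c) \<otimes> inv c"
    using assms sub by (simp add: m_assoc inv_solve_left)
  then show ?thesis
    using *[OF assms(3,4,5)] *[of "inv b" "inv c" "b \<otimes> x \<otimes> c"] assms sub
      subgroup.m_inv_closed[OF assms(1)] subgroup.m_inv_closed[OF assms(2)] by auto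
qed

lemma (in group) q_map_dcoset:
  assumes "subgroup B G" "subgroup C G" "f \<in> carrier G" "g \<in> carrier G" "a \<in> carrier G"
    and H: "\<one> \<in> H" "H \<subseteq> gconj G f ` B" and K: "\<one> \<in> K" "K \<subseteq> gconj G g ` C"
  shows "q_map G B C f g (dcoset G H a K) = dcoset G B (f \<otimes> a \<otimes> inv g) C"
proof -
  note sub = subgroup.mem_carrier[OF assms(1)] subgroup.mem_carrier[OF assms(2)]
  have "dcoset G B (f \<otimes> (h \<otimes> a \<otimes> k) \<otimes> inv g) C = dcoset G B (f \<otimes> a \<otimes> inv g) C"
    if hk: "h \<in> H" "k \<in> K" for h k
  proof -
    obtain b c where b: "b \<in> B" "h = inv f \<otimes> b \<otimes> f" and c: "c \<in> C" "k = inv g \<otimes> c \<otimes> g"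
      using H K hk unfolding gconj_def by blast
    have "f \<otimes> (h \<otimes> a \<otimes> k) \<otimes> inv g = b \<otimes> (f \<otimes> a \<otimes> inv g) \<otimes> c"
    proof -
      have hkG: "h \<in> carrier G" "k \<in> carrier G"
        using b c assms sub by auto
      have eqs: "f \<otimes> h = b \<otimes> f" "k \<otimes> inv g = inv g \<otimes> c"
        using b c assms sub by (simp_all add: m_assoc[symmetric]) (simp add: m_assoc)
      have "f \<otimes> (h \<otimes> a \<otimes> k) \<otimes> inv g = (f \<otimes> h) \<otimes> a \<otimes> (k \<otimes> inv g)"
        using hkG assms by (simp add: m_assoc)
      also have "\<dots> = b \<otimes> (f \<otimes> a \<otimes> inv g) \<otimes> c"
        unfolding eqs using assms b c sub by (simp add: m_assoc)
      finally show ?thesis .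
    qed
    then show ?thesis
      using dcoset_absorb[OF assms(1,2) b(1) c(1)] assms by simp
  qed
  then have "dcoset G B (f \<otimes> x \<otimes> inv g) C = dcoset G B (f \<otimes> a \<otimes> inv g) C"
    if "x \<in> dcoset G H a K" for x
    using that by (auto simp: mem_dcoset)
  moreover have "a \<in> dcoset G H a K"
    unfolding mem_dcoset by (rule bexI[OF _ H(1)], rule bexI[OF _ K(1)]) (simp add: assms(5))
  ultimately show ?thesis
    unfolding q_map_def by blast
qed

lemma dcoset_eq_image: "dcoset G H g K = (\<lambda>(h, k). h \<otimes>\<^bsub>G\<^esub> g \<otimes>\<^bsub>G\<^esub> k) ` (H \<times> K)"
  unfolding dcoset_def r_coset_def set_mult_def by auto

lemma hom_image_dcoset:
  assumes "\<phi> \<in> hom G G'" "H \<subseteq> carrier G" "K \<subseteq> carrier G" "a \<in> carrier G" "group G"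
  shows "\<phi> ` dcoset G H a K = dcoset G' (\<phi> ` H) (\<phi> a) (\<phi> ` K)"
proof -
  interpret group G by fact
  have "\<phi> (h \<otimes>\<^bsub>G\<^esub> a \<otimes>\<^bsub>G\<^esub> k) = \<phi> h \<otimes>\<^bsub>G'\<^esub> \<phi> a \<otimes>\<^bsub>G'\<^esub> \<phi> k" if "h \<in> H" "k \<in> K" for h k
    using assms that by (auto simp: hom_mult subset_eq)
  then have "(\<lambda>(h, k). \<phi> (h \<otimes>\<^bsub>G\<^esub> a \<otimes>\<^bsub>G\<^esub> k)) ` (H \<times> K) =
      (\<lambda>(h, k). \<phi> h \<otimes>\<^bsub>G'\<^esub> \<phi> a \<otimes>\<^bsub>G'\<^esub> \<phi> k) ` (H \<times> K)"
    by (intro image_cong) auto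
  moreover have "\<phi> ` H \<times> \<phi> ` K = map_prod \<phi> \<phi> ` (H \<times> K)"
    by (simp add: map_prod_surj_on)
  ultimately show ?thesis
    by (simp add: dcoset_eq_image image_image case_prod_beta')
qed

context
  fixes A :: "('v, 'e, 'a, 'b) graph_of_groups"
    and B :: "('v1, 'e1, 'a1, 'b1) graph_of_groups"
    and \<mu> :: "('v1, 'e1, 'a1, 'b1, 'v, 'e, 'a, 'b) gog_map"
  assumes A: "is_graph_of_groups A" and B: "is_graph_of_groups B" and \<mu>: "gog_morphism B A \<mu>"
begin

lemma vimg_subgroup: "v \<in> verts B \<Longrightarrow> subgroup (vimg B \<mu> v) (vgrp A (vmap \<mu> v))"
  using A B \<mu> unfolding is_graph_of_groups_def gog_morphism_def vimg_def mon_def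
  by (auto intro!: group_hom.img_is_subgroup simp: group_hom_def group_hom_axioms_def)

lemma eimg_subgroup: "f \<in> edges B \<Longrightarrow> subgroup (eimg B \<mu> f) (egrp A (emap \<mu> f))"
  using A B \<mu> unfolding is_graph_of_groups_def gog_morphism_def eimg_def mon_def
  by (auto intro!: group_hom.img_is_subgroup simp: group_hom_def group_hom_axioms_def)

lemma emb_eimg_subset:
  assumes "f \<in> edges B"
  shows "emb A (emap \<mu> f) ` eimg B \<mu> f \<subseteq>
    gconj (vgrp A (vmap \<mu> (org B f))) (twist \<mu> f) ` vimg B \<mu> (org B f)"
  using assms B \<mu> unfolding is_graph_of_groups_def gog_morphism_def eimg_def vimg_def mon_def
  by (auto simp: hom_def Pi_iff)

lemma eimg_einv: "f \<in> edges B \<Longrightarrow> eimg B \<mu> (einv B f) = eimg B \<mu> f"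
  using B \<mu> unfolding is_graph_of_groups_def gog_morphism_def eimg_def by auto

end

context
  fixes A :: "('v, 'e, 'a, 'b) graph_of_groups"
    and B :: "('v1, 'e1, 'a1, 'b1) graph_of_groups"
    and C :: "('v2, 'e2, 'a2, 'b2) graph_of_groups"
    and \<mu> :: "('v1, 'e1, 'a1, 'b1, 'v, 'e, 'a, 'b) gog_map"
    and \<nu> :: "('v2, 'e2, 'a2, 'b2, 'v, 'e, 'a, 'b) gog_map"
  assumes A: "is_graph_of_groups A" and B: "is_graph_of_groups B" and C: "is_graph_of_groups C"
    and \<mu>: "gog_morphism B A \<mu>" and \<nu>: "gog_morphism C A \<nu>"
begin

lemma org_aproduct:
  assumes f: "f \<in> edges B" and g: "g \<in> edges C" and fg: "emap \<mu> f = emap \<nu> g"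
    and a: "a \<in> carrier (egrp A (emap \<mu> f))"
  defines "G \<equiv> vgrp A (vmap \<mu> (org B f))"
  shows "org (aproduct A B C \<mu> \<nu>) (f, g, dcoset (egrp A (emap \<mu> f)) (eimg B \<mu> f) a (eimg C \<nu> g)) =
    (org B f, org C g,
     dcoset G (vimg B \<mu> (org B f))
       (twist \<mu> f \<otimes>\<^bsub>G\<^esub> emb A (emap \<mu> f) a \<otimes>\<^bsub>G\<^esub> inv\<^bsub>G\<^esub> twist \<nu> g) (vimg C \<nu> (org C g)))"
proof -
  have orgs: "org B f \<in> verts B" "org C g \<in> verts C"
    using B C f g by (auto simp: is_graph_of_groups_def is_graph_def)
  have maps: "vmap \<mu> (org B f) = org A (emap \<mu> f)" "vmap \<nu> (org C g) = org A (emap \<mu> f)"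
    using \<mu> \<nu> f g fg by (auto simp: gog_morphism_def)
  have e: "emap \<mu> f \<in> edges A" using \<mu> f by (auto simp: gog_morphism_def)
  have G: "group G" using A e maps
    by (auto simp: G_def is_graph_of_groups_def is_graph_def)
  have E: "group (egrp A (emap \<mu> f))" using A e by (auto simp: is_graph_of_groups_def)
  have hom: "emb A (emap \<mu> f) \<in> hom (egrp A (emap \<mu> f)) G"
    using A e maps by (auto simp: G_def is_graph_of_groups_def mon_def)
  have sB: "subgroup (eimg B \<mu> f) (egrp A (emap \<mu> f))"
    by (rule eimg_subgroup[OF A B \<mu> f])
  have sC: "subgroup (eimg C \<nu> g) (egrp A (emap \<mu> f))"
    using eimg_subgroup[OF A C \<nu> g] fg by simp
  have one: "emb A (emap \<mu> f) \<one>\<^bsub>egrp A (emap \<mu> f)\<^esub> = \<one>\<^bsub>G\<^esub>"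
    using hom E G by (rule hom_one)
  have sub: "subgroup (vimg B \<mu> (org B f)) G" "subgroup (vimg C \<nu> (org C g)) G"
    using vimg_subgroup[OF A B \<mu> orgs(1)] vimg_subgroup[OF A C \<nu> orgs(2)] maps
    by (simp_all add: G_def)
  have "q_map G (vimg B \<mu> (org B f)) (vimg C \<nu> (org C g)) (twist \<mu> f) (twist \<nu> g)
     (dcoset G (emb A (emap \<mu> f) ` eimg B \<mu> f) (emb A (emap \<mu> f) a) (emb A (emap \<mu> f) ` eimg C \<nu> g)) =
    dcoset G (vimg B \<mu> (org B f))
       (twist \<mu> f \<otimes>\<^bsub>G\<^esub> emb A (emap \<mu> f) a \<otimes>\<^bsub>G\<^esub> inv\<^bsub>G\<^esub> twist \<nu> g) (vimg C \<nu> (org C g))"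
  proof (rule group.q_map_dcoset[OF G sub])
    show "twist \<mu> f \<in> carrier G" "twist \<nu> g \<in> carrier G"
      using \<mu> \<nu> f g maps by (auto simp: gog_morphism_def G_def)
    show "emb A (emap \<mu> f) a \<in> carrier G" using hom a by (rule hom_in_carrier)
    show "\<one>\<^bsub>G\<^esub> \<in> emb A (emap \<mu> f) ` eimg B \<mu> f" "\<one>\<^bsub>G\<^esub> \<in> emb A (emap \<mu> f) ` eimg C \<nu> g"
      using one subgroup.one_closed[OF sB] subgroup.one_closed[OF sC] by (metis imageI)+
    show "emb A (emap \<mu> f) ` eimg B \<mu> f \<subseteq> gconj G (twist \<mu> f) ` vimg B \<mu> (org B f)"
      using emb_eimg_subset[OF A B \<mu> f] by (simp add: G_def)
    show "emb A (emap \<mu> f) ` eimg C \<nu> g \<subseteq> gconj G (twist \<nu> g) ` vimg C \<nu> (org C g)"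
      using emb_eimg_subset[OF A C \<nu> g] fg maps by (simp add: G_def)
  qed
  then show ?thesis
    using hom_image_dcoset[OF hom subgroup.subset[OF sB] subgroup.subset[OF sC] a E]
    by (simp add: aproduct_def G_def)
qed

lemma is_graph_aproduct: "is_graph (aproduct A B C \<mu> \<nu>)"
proof -
  let ?P = "aproduct A B C \<mu> \<nu>"
  have "org ?P x \<in> verts ?P \<and> einv ?P x \<in> edges ?P \<and> einv ?P x \<noteq> x \<and> einv ?P (einv ?P x) = x"
    if x_edge: "x \<in> edges ?P" for x
  proof -
    obtain f g a where x: "x = (f, g, dcoset (egrp A (emap \<mu> f)) (eimg B \<mu> f) a (eimg C \<nu> g))"
      and f: "f \<in> edges B" and g: "g \<in> edges C" and fg: "emap \<mu> f = emap \<nu> g"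
      and a: "a \<in> carrier (egrp A (emap \<mu> f))"
      using x_edge by (auto simp: aproduct_def double_cosets_def)
    have fi: "einv B f \<in> edges B" "einv B f \<noteq> f" "einv B (einv B f) = f" "org B f \<in> verts B"
      and gi: "einv C g \<in> edges C" "einv C (einv C g) = g" "org C g \<in> verts C"
      using B C f g by (auto simp: is_graph_of_groups_def is_graph_def)
    have e: "emap \<mu> f \<in> edges A" using \<mu> f by (auto simp: gog_morphism_def)
    let ?G = "vgrp A (vmap \<mu> (org B f))"
    have maps: "vmap \<mu> (org B f) = org A (emap \<mu> f)" "vmap \<nu> (org C g) = org A (emap \<mu> f)"
      "emap \<mu> (einv B f) = einv A (emap \<mu> f)" "emap \<nu> (einv C g) = einv A (emap \<mu> f)"
      using \<mu> \<nu> f g fg by (auto simp: gog_morphism_def)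
    interpret group ?G using A e maps by (auto simp: is_graph_of_groups_def is_graph_def)
    have "emb A (emap \<mu> f) \<in> hom (egrp A (emap \<mu> f)) ?G"
      using A e maps by (auto simp: is_graph_of_groups_def mon_def)
    then have c: "emb A (emap \<mu> f) a \<in> carrier ?G" using a by (rule hom_in_carrier)
    have t: "twist \<mu> f \<in> carrier ?G" "twist \<nu> g \<in> carrier ?G"
      using \<mu> \<nu> f g maps by (auto simp: gog_morphism_def)
    have "twist \<mu> f \<otimes>\<^bsub>?G\<^esub> emb A (emap \<mu> f) a \<otimes>\<^bsub>?G\<^esub> inv\<^bsub>?G\<^esub> twist \<nu> g \<in> carrier ?G"
      using c t by simp
    then have "org ?P x \<in> verts ?P"
      unfolding x org_aproduct[OF f g fg a] using fi gi maps
      by (auto simp: aproduct_def double_cosets_def)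
    moreover have "egrp A (einv A (emap \<mu> f)) = egrp A (emap \<mu> f)"
      using A e by (auto simp: is_graph_of_groups_def)
    then have "einv ?P x \<in> edges ?P"
      using fi gi maps a eimg_einv[OF A B \<mu> f] eimg_einv[OF A C \<nu> g] unfolding x
      by (auto simp: aproduct_def double_cosets_def)
    moreover have "einv ?P x \<noteq> x" "einv ?P (einv ?P x) = x"
      using fi gi unfolding x by (auto simp: aproduct_def)
    ultimately show ?thesis by blast
  qed
  then show ?thesis unfolding is_graph_def by blast
qed

lemma tgt_aproduct:
  assumes f: "f \<in> edges B" and g: "g \<in> edges C" and fg: "emap \<mu> f = emap \<nu> g"
    and a: "a \<in> carrier (egrp A (emap \<mu> f))"
  defines "G \<equiv> vgrp A (vmap \<mu> (tgt B f))"
  shows "tgt (aproduct A B C \<mu> \<nu>) (f, g, dcoset (egrp A (emap \<mu> f)) (eimg B \<mu> f) a (eimg C \<nu> g)) =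
    (tgt B f, tgt C g,
     dcoset G (vimg B \<mu> (tgt B f))
       (twist \<mu> (einv B f) \<otimes>\<^bsub>G\<^esub> emb A (einv A (emap \<mu> f)) a \<otimes>\<^bsub>G\<^esub> inv\<^bsub>G\<^esub> twist \<nu> (einv C g))
       (vimg C \<nu> (tgt C g)))"
proof -
  have i: "einv B f \<in> edges B" "einv C g \<in> edges C"
    using B C f g by (auto simp: is_graph_of_groups_def is_graph_def)
  have e: "emap \<mu> f \<in> edges A" using \<mu> f by (auto simp: gog_morphism_def)
  have maps: "emap \<mu> (einv B f) = einv A (emap \<mu> f)" "emap \<nu> (einv C g) = einv A (emap \<mu> f)"
    using \<mu> \<nu> f g fg by (auto simp: gog_morphism_def)
  have E: "egrp A (einv A (emap \<mu> f)) = egrp A (emap \<mu> f)"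
    using A e by (auto simp: is_graph_of_groups_def)
  show ?thesis
    using org_aproduct[OF i, of a] maps E a eimg_einv[OF A B \<mu> f] eimg_einv[OF A C \<nu> g]
    by (simp add: G_def tgt_def aproduct_def)
qed

end

end

theory Submission
  imports Defs
begin

text \<open>
  Fix vertices \<open>v\<close> of \<open>B\<close> and \<open>w\<close> of \<open>C\<close> over the same vertex \<open>u\<close> of \<open>A\<close>. The edges leaving a
  vertex \<open>(v, w, D)\<close> of the product are sorted by the pair \<open>(f, g)\<close> of edges below them. By the
  second immersion condition the double cosets of edge images in \<open>A\<^sub>e\<close> are, after applying \<open>\<alpha>\<^sub>e\<close>,
  exactly the double cosets on which the map \<open>q\<close> with parameters \<open>f\<^sub>\<alpha>\<close>, \<open>g\<^sub>\<alpha>\<close> is defined, and the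
  origin map of the product is that map. So the \<open>(f, g)\<close>-edges at \<open>(v, w, D)\<close> embed into a fibre of
  \<open>q\<close> over \<open>D\<close> (\<open>emeasure_star_pair_le_q_fibre\<close>). By the first immersion condition the twisting
  elements of the edges at \<open>v\<close> over a given \<open>e\<close> lie in distinct double cosets
  (\<open>inj_on_dcoset_twist\<close>), so they are admissible families in the k-f.c.i.p. of \<open>A\<^sub>u\<close>, and the
  degree of \<open>(v, w, D)\<close> is at most the number from which \<open>k\<close> is subtracted there
  (\<open>emeasure_star_aproduct_le\<close>).

  The sum of the excesses over all \<open>D\<close> is finite. Hence no degree is infinite; and a degree
  larger than \<open>k\<close>, being an integer, exceeds \<open>k\<close> by at least the fixed amount
  \<open>\<lfloor>k\<rfloor> + 1 - k\<close>, so only finitely many \<open>D\<close> have one (\<open>finite_card_gt_of_excess\<close>). There are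
  finitely many pairs \<open>(v, w)\<close>, which gives the two main assertions.

  For \<open>k = 0\<close> all edges start at the finitely many vertices with an outgoing edge. For \<open>k = 1\<close>, a
  walk from \<open>x\<close> that leaves the finite set consisting of \<open>x\<close> and the vertices of degree at least \<open>2\<close>
  reaches a dead end and can only turn back, so every vertex of the component is in this set
  or adjacent to it (\<open>finite_component_edges\<close>).
\<close>

section \<open>Cardinalities as extended non-negative reals\<close>

lemma emeasure_count_space_le_inj:
  assumes "inj_on h S" "h ` S \<subseteq> T"
  shows "emeasure (count_space UNIV) S \<le> emeasure (count_space UNIV) T"
proof (cases "finite T")
  case True
  then have "finite S" "card S \<le> card T"
    using assms by (auto intro: inj_on_finite card_inj_on_le)
  with True show ?thesis by (simp add: emeasure_count_space)
qed (simp add: emeasure_count_space)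

text \<open>
  Integrality of cardinalities is what turns a finite total excess over \<open>k\<close> into finitely many
  exceptions: a cardinality above \<open>k\<close> is at least \<open>\<lfloor>k\<rfloor> + 1\<close>.
\<close>

lemma finite_card_gt_of_excess:
  fixes h :: "'a \<Rightarrow> ennreal" and k :: real
  assumes k: "k \<ge> 0"
    and fin: "(\<Sum>\<^sub>\<infinity>D\<in>S. h D - ennreal k) < \<infinity>"
    and le: "\<And>D. D \<in> S \<Longrightarrow> emeasure (count_space UNIV) (X D) \<le> h D"
  shows "\<And>D. D \<in> S \<Longrightarrow> finite (X D)"
    and "finite {D \<in> S. real (card (X D)) > k}"
proof -
  let ?t = "\<Sum>\<^sub>\<infinity>D\<in>S. h D - ennreal k"
  have part: "(\<Sum>D\<in>F. h D - ennreal k) \<le> ?t" if "finite F" "F \<subseteq> S" for F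
  proof -
    have "(\<Sum>D\<in>F. h D - ennreal k) = (\<Sum>\<^sub>\<infinity>D\<in>F. h D - ennreal k)"
      using that by simp
    also have "\<dots> \<le> ?t"
      by (rule infsum_mono_neutral) (use that in \<open>auto intro: nonneg_summable_on_complete\<close>)
    finally show ?thesis .
  qed
  show "finite (X D)" if D: "D \<in> S" for D
  proof (rule ccontr)
    assume "infinite (X D)"
    then have "h D = \<infinity>" using le[OF D] by (simp add: emeasure_count_space top_unique)
    then show False using part[of "{D}"] D fin by (simp add: top_unique)
  qed
  note finX = this
  \<comment> \<open>the least positive value of \<open>n - k\<close> for an integer \<open>n\<close>\<close>
  define \<delta> where "\<delta> = of_int (\<lfloor>k\<rfloor> + 1) - k"
  have \<delta>: "\<delta> > 0" unfolding \<delta>_def by linarith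
  let ?L = "{D \<in> S. real (card (X D)) > k}"
  have step: "ennreal \<delta> \<le> h D - ennreal k" if "D \<in> ?L" for D
  proof -
    have "\<lfloor>k\<rfloor> < int (card (X D))"
      using that by (simp add: floor_less_iff)
    then have "\<delta> \<le> real (card (X D)) - k"
      unfolding \<delta>_def by linarith
    then have "ennreal \<delta> \<le> ennreal (real (card (X D)) - k)"
      by (rule ennreal_leI)
    also have "\<dots> = of_nat (card (X D)) - ennreal k"
      using k by (simp add: ennreal_minus ennreal_of_nat_eq_real_of_nat)
    also have "\<dots> \<le> h D - ennreal k"
      using le[of D] finX[of D] that by (intro ennreal_minus_mono) (auto simp: emeasure_count_space)
    finally show ?thesis .
  qed
  show "finite ?L"
  proof (rule ccontr)
    assume inf: "infinite ?L"
    have bound: "of_nat n * ennreal \<delta> \<le> ?t" for n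
    proof -
      obtain F where F: "finite F" "card F = n" "F \<subseteq> ?L"
        using infinite_arbitrarily_large[OF inf] by blast
      have "of_nat n * ennreal \<delta> = (\<Sum>D\<in>F. ennreal \<delta>)" using F by simp
      also have "\<dots> \<le> (\<Sum>D\<in>F. h D - ennreal k)"
        using F step by (intro sum_mono) blast
      also have "\<dots> \<le> ?t" using F by (intro part) auto
      finally show ?thesis .
    qed
    obtain t where t: "?t = ennreal t" "t \<ge> 0"
      using fin by (cases ?t) auto
    obtain n :: nat where "real n * \<delta> > t"
      using reals_Archimedean3[OF \<delta>] by blast
    then have "ennreal t < of_nat n * ennreal \<delta>"
      using t \<delta> \<open>real n * \<delta> > t\<close>
      by (simp add: ennreal_of_nat_eq_real_of_nat ennreal_mult[symmetric]
          ennreal_less_iff)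
    with bound[of n] t show False by simp
  qed
qed

section \<open>Degrees and components of graphs\<close>

lemma finite_star:
  assumes "is_graph X" "locally_finite X"
  shows "finite (star X u)"
proof (cases "u \<in> verts X")
  case False
  then have "star X u = {}" using assms(1) by (auto simp: star_def is_graph_def)
  then show ?thesis by simp
qed (use assms(2) in \<open>simp add: locally_finite_def\<close>)

text \<open>
  Let \<open>U\<close> consist of \<open>x\<close> and the vertices of degree at least \<open>2\<close>. A neighbour of \<open>U\<close>
  outside \<open>U\<close> has degree \<open>1\<close>, so its only edge leads back to \<open>U\<close>; hence \<open>U\<close> together with its
  neighbours is closed under moving along edges.
\<close>

lemma finite_component_edges:
  assumes X: "is_graph X" "locally_finite X"
    and fin: "finite {y \<in> verts X. card (star X y) > 1}"
  shows "finite {e \<in> edges X. org X e \<in> component X x}"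
proof -
  define U where "U = insert x {y \<in> verts X. card (star X y) > 1}"
  define T where "T = U \<union> (\<Union>y\<in>U. tgt X ` star X y)"
  note finS = finite_star[OF X]
  have inv: "einv X e \<in> edges X" "einv X (einv X e) = e" "org X e \<in> verts X"
    if "e \<in> edges X" for e using X(1) that by (auto simp: is_graph_def)
  have T: "finite T" unfolding T_def U_def using fin finS by auto
  have closed: "tgt X e \<in> T" if e: "e \<in> edges X" and o: "org X e \<in> T" for e
  proof (cases "org X e \<in> U")
    case True
    then show ?thesis using e by (auto simp: T_def star_def)
  next
    case False
    then obtain d where d: "d \<in> edges X" "org X d \<in> U" "tgt X d = org X e"
      using o by (auto simp: T_def star_def)
    have "card (star X (org X e)) \<le> 1"
      using False inv(3)[OF e] by (auto simp: U_def)
    moreover have "e \<in> star X (org X e)" "einv X d \<in> star X (org X e)"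
      using e d inv(1)[OF d(1)] by (auto simp: star_def tgt_def)
    ultimately have "e = einv X d"
      using card_le_Suc0_iff_eq[OF finS[of "org X e"]] by auto
    then have "tgt X e = org X d" using inv(2)[OF d(1)] by (simp add: tgt_def)
    then show ?thesis using d(2) by (simp add: T_def)
  qed
  have "y \<in> T" if "y \<in> component X x" for y
    using that[unfolded component_def mem_Collect_eq]
    by (induction rule: rtrancl_induct) (auto simp: closed, simp add: T_def U_def)
  then have "{e \<in> edges X. org X e \<in> component X x} \<subseteq> (\<Union>y\<in>T. star X y)"
    by (auto simp: star_def)
  then show ?thesis using T finS by (auto intro: finite_subset)
qed

lemma finite_edges_if_finite_positive_degree:
  assumes X: "is_graph X" "locally_finite X"
    and fin: "finite {y \<in> verts X. card (star X y) > 0}"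
  shows "finite (edges X)"
proof -
  have "edges X \<subseteq> (\<Union>y\<in>{y \<in> verts X. card (star X y) > 0}. star X y)"
  proof
    fix e assume e: "e \<in> edges X"
    then have "e \<in> star X (org X e)" "org X e \<in> verts X"
      using X(1) by (auto simp: star_def is_graph_def)
    then show "e \<in> (\<Union>y\<in>{y \<in> verts X. card (star X y) > 0}. star X y)"
      using finite_star[OF X, of "org X e"] by (auto simp: card_gt_0_iff)
  qed
  then show ?thesis using fin finite_star[OF X] by (auto intro: finite_subset)
qed

section \<open>Local data of an immersion at a vertex\<close>

definition edges_over ::
  "('v, 'e, 'a, 'b) graph_of_groups \<Rightarrow> ('v, 'e, 'a, 'b, 'v1, 'e1, 'a1, 'b1) gog_map \<Rightarrow>
   'v \<Rightarrow> 'e1 \<Rightarrow> 'e set" where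
  "edges_over B \<mu> v e = {f \<in> star B v. emap \<mu> f = e}"

context
  fixes A :: "('v, 'e, 'a, 'b) graph_of_groups"
    and B :: "('v1, 'e1, 'a1, 'b1) graph_of_groups"
    and \<mu> :: "('v1, 'e1, 'a1, 'b1, 'v, 'e, 'a, 'b) gog_map"
  assumes A: "is_graph_of_groups A" and B: "finite_graph_of_fg_groups B"
    and \<mu>: "gog_immersion B A \<mu>"
begin

lemma fg_subgroup_vimg:
  assumes v: "v \<in> verts B"
  shows "fg_subgroup (vgrp A (vmap \<mu> v)) (vimg B \<mu> v)"
proof -
  have gog: "is_graph_of_groups B" and mor: "gog_morphism B A \<mu>"
    using B \<mu> by (auto simp: finite_graph_of_fg_groups_def gog_immersion_def)
  obtain S where S: "finite S" "S \<subseteq> carrier (vgrp B v)" "carrier (vgrp B v) = generate (vgrp B v) S"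
    using B v by (auto simp: finite_graph_of_fg_groups_def fg_group_def)
  interpret group_hom "vgrp B v" "vgrp A (vmap \<mu> v)" "vhom \<mu> v"
    using A gog mor v
    by (auto simp: group_hom_def group_hom_axioms_def is_graph_of_groups_def gog_morphism_def mon_def)
  have "vimg B \<mu> v = generate (vgrp A (vmap \<mu> v)) (vhom \<mu> v ` S)"
    using generate_img[OF S(2)] S(3) by (simp add: vimg_def)
  moreover have "vhom \<mu> v ` S \<subseteq> carrier (vgrp A (vmap \<mu> v))" using S(2) by auto
  ultimately show ?thesis
    using S(1) vimg_subgroup[OF A gog mor v] unfolding fg_subgroup_def by blast
qed

lemma finite_edges_over: "finite (edges_over B \<mu> v e)"
  using B by (simp add: edges_over_def star_def finite_graph_of_fg_groups_def finite_graph_def)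

lemma inj_on_dcoset_twist:
  "inj_on (\<lambda>f. dcoset (vgrp A (vmap \<mu> v)) (vimg B \<mu> v) (twist \<mu> f) (edge_subgroup A e))
     (edges_over B \<mu> v e)"
  using \<mu> unfolding gog_immersion_def inj_on_def edges_over_def star_def by auto

lemma inj_on_twist: "inj_on (twist \<mu>) (edges_over B \<mu> v e)"
  using inj_on_dcoset_twist[of v e] by (auto simp: inj_on_def)

text \<open>
  The twisting elements at \<open>v\<close>, sorted by the edge \<open>e\<close> below, form a choice of finite sets as
  quantified over in the relative k-f.c.i.p.
\<close>

lemma twist_family_admissible:
  "finite (twist \<mu> ` edges_over B \<mu> v e)"
  "twist \<mu> ` edges_over B \<mu> v e \<subseteq> carrier (vgrp A (vmap \<mu> v))"
  "inj_on (\<lambda>s. dcoset (vgrp A (vmap \<mu> v)) (vimg B \<mu> v) s (edge_subgroup A e))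
     (twist \<mu> ` edges_over B \<mu> v e)"
proof -
  show "finite (twist \<mu> ` edges_over B \<mu> v e)" using finite_edges_over by simp
  show "twist \<mu> ` edges_over B \<mu> v e \<subseteq> carrier (vgrp A (vmap \<mu> v))"
    using \<mu> by (auto simp: edges_over_def star_def gog_immersion_def gog_morphism_def)
  show "inj_on (\<lambda>s. dcoset (vgrp A (vmap \<mu> v)) (vimg B \<mu> v) s (edge_subgroup A e))
     (twist \<mu> ` edges_over B \<mu> v e)"
    using inj_on_dcoset_twist[of v e] by (auto simp: inj_on_def)
qed

lemma emb_eimg_immersion:
  assumes "f \<in> edges_over B \<mu> v e"
  shows "emb A e ` eimg B \<mu> f =
    edge_subgroup A e \<inter> gconj (vgrp A (vmap \<mu> v)) (twist \<mu> f) ` vimg B \<mu> v"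
proof -
  have "f \<in> edges B" "org B f = v" "emap \<mu> f = e"
    using assms by (auto simp: edges_over_def star_def)
  then show ?thesis
    using \<mu> unfolding gog_immersion_def by (metis Int_commute)
qed

end

section \<open>Stars of the product\<close>

context
  fixes A :: "('v, 'e, 'a, 'b) graph_of_groups"
    and B :: "('v1, 'e1, 'a1, 'b1) graph_of_groups"
    and C :: "('v2, 'e2, 'a2, 'b2) graph_of_groups"
    and \<mu> :: "('v1, 'e1, 'a1, 'b1, 'v, 'e, 'a, 'b) gog_map"
    and \<nu> :: "('v2, 'e2, 'a2, 'b2, 'v, 'e, 'a, 'b) gog_map"
  assumes A: "is_graph_of_groups A"
    and B: "finite_graph_of_fg_groups B" and C: "finite_graph_of_fg_groups C"
    and \<mu>: "gog_immersion B A \<mu>" and \<nu>: "gog_immersion C A \<nu>"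
begin

text \<open>
  The embedding is \<open>E \<mapsto> \<alpha>\<^sub>e(E)\<close>: it is injective because \<open>\<alpha>\<^sub>e\<close> is, and it lands in the domain of
  \<open>q\<close> because the immersion condition identifies \<open>\<alpha>\<^sub>e\<close> of the edge images with the intersections
  occurring there.
\<close>

lemma emeasure_star_pair_le_q_fibre:
  assumes vw: "vmap \<mu> v = vmap \<nu> w"
    and f: "f \<in> edges_over B \<mu> v e" and g: "g \<in> edges_over C \<nu> w e"
  shows "emeasure (count_space UNIV)
        {x \<in> star (aproduct A B C \<mu> \<nu>) (v, w, D). fst x = f \<and> fst (snd x) = g}
    \<le> emeasure (count_space UNIV)
        (q_fibre (vgrp A (vmap \<mu> v)) (edge_subgroup A e) (vimg B \<mu> v) (vimg C \<nu> w)
           (twist \<mu> f) (twist \<nu> g) D)"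
    (is "_ \<le> emeasure _ (q_fibre ?G _ _ _ _ _ _)")
proof (rule emeasure_count_space_le_inj)
  let ?S = "{x \<in> star (aproduct A B C \<mu> \<nu>) (v, w, D). fst x = f \<and> fst (snd x) = g}"
  let ?h = "\<lambda>(f, g, E). emb A e ` E"
  let ?E = "egrp A e"
  have gog: "is_graph_of_groups B" "is_graph_of_groups C"
    and mor: "gog_morphism B A \<mu>" "gog_morphism C A \<nu>"
    using B C \<mu> \<nu> by (auto simp: finite_graph_of_fg_groups_def gog_immersion_def)
  have fg: "f \<in> edges B" "org B f = v" "emap \<mu> f = e" "g \<in> edges C" "org C g = w" "emap \<nu> g = e"
    using f g by (auto simp: edges_over_def star_def)
  have e: "e \<in> edges A" "org A e = vmap \<mu> v" using mor(1) fg by (auto simp: gog_morphism_def)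
  then have E: "group ?E" and hom: "emb A e \<in> hom ?E ?G" and inj: "inj_on (emb A e) (carrier ?E)"
    using A by (auto simp: is_graph_of_groups_def mon_def)
  interpret E: group ?E by fact
  have sub: "eimg B \<mu> f \<subseteq> carrier ?E" "eimg C \<nu> g \<subseteq> carrier ?E"
    using subgroup.subset[OF eimg_subgroup[OF A gog(1) mor(1) fg(1)]]
      subgroup.subset[OF eimg_subgroup[OF A gog(2) mor(2) fg(4)]] fg by auto
  have dc: "K \<subseteq> carrier ?E" if "K \<in> double_cosets ?E (eimg B \<mu> f) (eimg C \<nu> g)" for K
    using that sub by (fastforce simp: double_cosets_def mem_dcoset)
  have S: "K \<in> double_cosets ?E (eimg B \<mu> f) (eimg C \<nu> g) \<and>
      q_map ?G (vimg B \<mu> v) (vimg C \<nu> w) (twist \<mu> f) (twist \<nu> g) (emb A e ` K) = D"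
    if "(f', g', K) \<in> ?S" for f' g' K
    using that fg by (auto simp: star_def aproduct_def)
  show "inj_on ?h ?S"
  proof (rule inj_onI)
    fix x y assume xy: "x \<in> ?S" "y \<in> ?S" "?h x = ?h y"
    obtain K L where KL: "x = (f, g, K)" "y = (f, g, L)"
      using xy(1,2) by (cases x; cases y) auto
    have "K \<subseteq> carrier ?E" "L \<subseteq> carrier ?E" using S dc xy(1,2) unfolding KL by blast+
    then show "x = y" using inj_on_image_eq_iff[OF inj] xy(3) KL by simp
  qed
  show "?h ` ?S \<subseteq> q_fibre ?G (edge_subgroup A e) (vimg B \<mu> v) (vimg C \<nu> w) (twist \<mu> f) (twist \<nu> g) D"
  proof
    fix Y assume "Y \<in> ?h ` ?S"
    then obtain f' g' K where "(f', g', K) \<in> ?S" and Y: "Y = emb A e ` K" by auto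
    note K = S[OF this(1)]
    then obtain a where a: "a \<in> carrier ?E" "K = dcoset ?E (eimg B \<mu> f) a (eimg C \<nu> g)"
      by (auto simp: double_cosets_def)
    have "emb A e ` K = dcoset ?G
        (edge_subgroup A e \<inter> gconj ?G (twist \<mu> f) ` vimg B \<mu> v) (emb A e a)
        (edge_subgroup A e \<inter> gconj ?G (twist \<nu> g) ` vimg C \<nu> w)"
      using hom_image_dcoset[OF hom sub a(1) E] emb_eimg_immersion[OF A B \<mu> f]
        emb_eimg_immersion[OF A C \<nu> g] a(2) vw by simp
    moreover have "emb A e a \<in> edge_subgroup A e" using a(1) by (simp add: edge_subgroup_def)
    ultimately have "emb A e ` K \<in> double_cosets (?G\<lparr>carrier := edge_subgroup A e\<rparr>)
        (edge_subgroup A e \<inter> gconj ?G (twist \<mu> f) ` vimg B \<mu> v)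
        (edge_subgroup A e \<inter> gconj ?G (twist \<nu> g) ` vimg C \<nu> w)"
      by (auto simp: double_cosets_def dcoset_eq_image)
    with K show "Y \<in> q_fibre ?G (edge_subgroup A e) (vimg B \<mu> v) (vimg C \<nu> w)
        (twist \<mu> f) (twist \<nu> g) D"
      by (simp add: q_fibre_def Y)
  qed
qed

lemma emeasure_star_aproduct_le:
  assumes finA: "finite_graph A" and vw: "vmap \<mu> v = vmap \<nu> w"
  shows "emeasure (count_space UNIV) (star (aproduct A B C \<mu> \<nu>) (v, w, D)) \<le>
    (\<Sum>\<^sub>\<infinity>e\<in>star A (vmap \<mu> v). \<Sum>s\<in>twist \<mu> ` edges_over B \<mu> v e. \<Sum>t\<in>twist \<nu> ` edges_over C \<nu> w e.
       emeasure (count_space UNIV)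
         (q_fibre (vgrp A (vmap \<mu> v)) (edge_subgroup A e) (vimg B \<mu> v) (vimg C \<nu> w) s t D))"
proof -
  let ?c = "emeasure (count_space UNIV)"
  let ?F = "edges_over B \<mu> v" and ?G = "edges_over C \<nu> w"
  let ?P = "star (aproduct A B C \<mu> \<nu>) (v, w, D)"
  let ?S = "\<lambda>f g. {x \<in> ?P. fst x = f \<and> fst (snd x) = g}"
  let ?Q = "\<lambda>e. q_fibre (vgrp A (vmap \<mu> v)) (edge_subgroup A e) (vimg B \<mu> v) (vimg C \<nu> w)"
  have finS: "finite (star A (vmap \<mu> v))"
    using finA by (simp add: star_def finite_graph_def)
  note finF = finite_edges_over[OF A B \<mu>] and finG = finite_edges_over[OF A C \<nu>]
  have "gog_morphism B A \<mu>" using \<mu> by (simp add: gog_immersion_def)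
  then have "?P \<subseteq> (\<Union>e\<in>star A (vmap \<mu> v). \<Union>f\<in>?F e. \<Union>g\<in>?G e. ?S f g)"
    by (fastforce simp: edges_over_def star_def aproduct_def gog_morphism_def)
  then have "?c ?P \<le> ?c (\<Union>e\<in>star A (vmap \<mu> v). \<Union>f\<in>?F e. \<Union>g\<in>?G e. ?S f g)"
    by (rule emeasure_mono) simp
  also have "\<dots> \<le> (\<Sum>e\<in>star A (vmap \<mu> v). ?c (\<Union>f\<in>?F e. \<Union>g\<in>?G e. ?S f g))"
    by (rule emeasure_subadditive_finite) (use finS in auto)
  also have "\<dots> \<le> (\<Sum>e\<in>star A (vmap \<mu> v). \<Sum>f\<in>?F e. ?c (\<Union>g\<in>?G e. ?S f g))"
    by (intro sum_mono emeasure_subadditive_finite) (use finF in auto)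
  also have "\<dots> \<le> (\<Sum>e\<in>star A (vmap \<mu> v). \<Sum>f\<in>?F e. \<Sum>g\<in>?G e. ?c (?S f g))"
    by (intro sum_mono emeasure_subadditive_finite) (use finG in auto)
  also have "\<dots> \<le> (\<Sum>e\<in>star A (vmap \<mu> v). \<Sum>f\<in>?F e. \<Sum>g\<in>?G e. ?c (?Q e (twist \<mu> f) (twist \<nu> g) D))"
    by (intro sum_mono emeasure_star_pair_le_q_fibre[OF vw])
  \<comment> \<open>Distinct edges over \<open>e\<close> have distinct twisting elements, so summing over these loses no edge.\<close>
  also have "\<dots> = (\<Sum>e\<in>star A (vmap \<mu> v). \<Sum>s\<in>twist \<mu> ` ?F e. \<Sum>t\<in>twist \<nu> ` ?G e. ?c (?Q e s t D))"
    by (simp add: sum.reindex[OF inj_on_twist[OF A B \<mu>]] sum.reindex[OF inj_on_twist[OF A C \<nu>]])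
  also have "\<dots> = (\<Sum>\<^sub>\<infinity>e\<in>star A (vmap \<mu> v). \<Sum>s\<in>twist \<mu> ` ?F e. \<Sum>t\<in>twist \<nu> ` ?G e. ?c (?Q e s t D))"
    using finS by simp
  finally show ?thesis .
qed

lemma finite_star_and_large_degree_fixed_pair:
  assumes finA: "finite_graph A" and k: "k \<ge> 0"
    and fcip: "fcip_relative k (vgrp A (vmap \<mu> v)) (star A (vmap \<mu> v)) (edge_subgroup A)"
    and v: "v \<in> verts B" and w: "w \<in> verts C" and vw: "vmap \<mu> v = vmap \<nu> w"
  defines "S \<equiv> double_cosets (vgrp A (vmap \<mu> v)) (vimg B \<mu> v) (vimg C \<nu> w)"
  shows "\<And>D. D \<in> S \<Longrightarrow> finite (star (aproduct A B C \<mu> \<nu>) (v, w, D))"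
    and "finite {D \<in> S. real (card (star (aproduct A B C \<mu> \<nu>) (v, w, D))) > k}"
proof -
  let ?h = "\<lambda>D. \<Sum>\<^sub>\<infinity>e\<in>star A (vmap \<mu> v). \<Sum>s\<in>twist \<mu> ` edges_over B \<mu> v e.
     \<Sum>t\<in>twist \<nu> ` edges_over C \<nu> w e. emeasure (count_space UNIV)
         (q_fibre (vgrp A (vmap \<mu> v)) (edge_subgroup A e) (vimg B \<mu> v) (vimg C \<nu> w) s t D)"
  have sum: "(\<Sum>\<^sub>\<infinity>D\<in>S. ?h D - ennreal k) < \<infinity>"
    unfolding S_def
    using fcip[unfolded fcip_relative_def, THEN conjunct2, THEN conjunct2,
        rule_format (no_asm), OF fg_subgroup_vimg[OF A B \<mu> v], of "vimg C \<nu> w"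
        "\<lambda>e. twist \<mu> ` edges_over B \<mu> v e" "\<lambda>e. twist \<nu> ` edges_over C \<nu> w e"]
      fg_subgroup_vimg[OF A C \<nu> w] twist_family_admissible[OF A B \<mu>, of v]
      twist_family_admissible[OF A C \<nu>, of w] vw
    by simp
  note le = emeasure_star_aproduct_le[OF finA vw]
  show "finite (star (aproduct A B C \<mu> \<nu>) (v, w, D))" if "D \<in> S" for D
    using finite_card_gt_of_excess(1)[OF k sum le that] .
  show "finite {D \<in> S. real (card (star (aproduct A B C \<mu> \<nu>) (v, w, D))) > k}"
    using finite_card_gt_of_excess(2)[OF k sum le] .
qed

end

section \<open>Finiteness properties of the product\<close>

theorem propositionD:
  fixes k :: real
    and A :: "('v, 'e, 'a, 'b) graph_of_groups"
    and B :: "('v1, 'e1, 'a1, 'b1) graph_of_groups"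
    and C :: "('v2, 'e2, 'a2, 'b2) graph_of_groups"
    and \<mu> :: "('v1, 'e1, 'a1, 'b1, 'v, 'e, 'a, 'b) gog_map"
    and \<nu> :: "('v2, 'e2, 'a2, 'b2, 'v, 'e, 'a, 'b) gog_map"
  assumes "k \<ge> 0"
    and "is_graph_of_groups A" and "finite_graph A"
    and "\<And>u. u \<in> verts A \<Longrightarrow> fcip_relative k (vgrp A u) (star A u) (edge_subgroup A)"
    and "finite_graph_of_fg_groups B" and "finite_graph_of_fg_groups C"
    and "gog_immersion B A \<mu>" and "gog_immersion C A \<nu>"
  shows "let P = aproduct A B C \<mu> \<nu> in
    locally_finite P \<and>
    finite {x \<in> verts P. real (card (star P x)) > k} \<and>
    (k = 0 \<longrightarrow> finite (edges P)) \<and>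
    (k = 1 \<longrightarrow> (\<forall>x \<in> verts P. finite {e \<in> edges P. org P e \<in> component P x}))"
proof -
  define P where "P = aproduct A B C \<mu> \<nu>"
  note finA = assms(3) and B = assms(5) and C = assms(6)
  have gog: "is_graph_of_groups B" "is_graph_of_groups C"
    and fin: "finite (verts B)" "finite (verts C)"
    and mor: "gog_morphism B A \<mu>" "gog_morphism C A \<nu>"
    using assms by (auto simp: finite_graph_of_fg_groups_def finite_graph_def gog_immersion_def)
  have P: "is_graph P"
    unfolding P_def by (rule is_graph_aproduct[OF assms(2) gog mor])
  define S where "S v w = double_cosets (vgrp A (vmap \<mu> v)) (vimg B \<mu> v) (vimg C \<nu> w)" for v w
  have verts: "x \<in> verts P \<longleftrightarrow>
      (\<exists>v w D. x = (v, w, D) \<and> v \<in> verts B \<and> w \<in> verts C \<and> vmap \<mu> v = vmap \<nu> w \<and> D \<in> S v w)" for x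
    by (auto simp: P_def aproduct_def S_def)
  have pair: "\<And>D. D \<in> S v w \<Longrightarrow> finite (star P (v, w, D))"
    "finite {D \<in> S v w. real (card (star P (v, w, D))) > k}"
    if "v \<in> verts B" "w \<in> verts C" "vmap \<mu> v = vmap \<nu> w" for v w
  proof -
    have "vmap \<mu> v \<in> verts A" using mor(1) that by (auto simp: gog_morphism_def)
    note * = finite_star_and_large_degree_fixed_pair[OF assms(2) B C assms(7,8) finA assms(1)
        assms(4)[OF this] that]
    show "finite (star P (v, w, D))" if "D \<in> S v w" for D
      using *(1) that by (simp add: P_def S_def)
    show "finite {D \<in> S v w. real (card (star P (v, w, D))) > k}"
      using *(2) by (simp add: P_def S_def)
  qed
  have lf: "locally_finite P"
    unfolding locally_finite_def using pair(1) by (auto simp: verts)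
  have "{x \<in> verts P. real (card (star P x)) > k} \<subseteq>
      (\<Union>(v, w)\<in>{(v, w) \<in> verts B \<times> verts C. vmap \<mu> v = vmap \<nu> w}.
         (\<lambda>D. (v, w, D)) ` {D \<in> S v w. real (card (star P (v, w, D))) > k})"
    by (auto simp: verts)
  moreover have "finite \<dots>"
  proof (rule finite_UN_I)
    show "finite {(v, w) \<in> verts B \<times> verts C. vmap \<mu> v = vmap \<nu> w}"
      using fin by (intro finite_subset[OF _ finite_cartesian_product]) auto
  qed (use pair(2) in auto)
  ultimately have large: "finite {x \<in> verts P. real (card (star P x)) > k}"
    by (rule finite_subset)
  have "finite (edges P)" if "k = 0"
    using finite_edges_if_finite_positive_degree[OF P lf] large that by simp
  moreover have "finite {e \<in> edges P. org P e \<in> component P x}" if "k = 1" for x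
    using finite_component_edges[OF P lf] large that by simp
  ultimately show ?thesis
    using lf large unfolding P_def[symmetric] Let_def by blast
qed

end
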